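(* Let $T$ be a tree of order $n\ge 3$, and let $s$ and $l$ be the number of support vertices and of pendant vertices of $T$, respectively. Then $$\gamma_{MR}(T)\le \left\lceil \frac{n+7s-5l}{4}\right\rceil,$$ and equality holds if and only if $T\in\mathcal{T}$, where $\mathcal{T}$ is the family of trees defined in the context.
   Context: All graphs are finite and simple. For a vertex $v$ of $G=(V,E)$, $N[v]=\{v\}\cup\{u: uv\in E\}$ is the closed neighborhood, and for $f:V\to\mathbb{R}$ and $S\subseteq V$, $f(S)=\sum_{x\in S}f(x)$. A majority Roman dominating function (MRDF) on $G$ is a function $f:V\to\{-1,1,2\}$ such that (i) $f(N[v])\ge 1$ for at least half of the vertices $v\in V$, and (ii) every vertex $u$ with $f(u)=-1$ is adjacent to at least one vertex $w$ with $f(w)=2$. The weight of $f$ is $f(V)$, and the majority Roman domination number $\gamma_{MR}(G)$ is the minimum weight of an MRDF on $G$. A pendant vertex is a vertex of degree $1$; a support vertex is a vertex adjacent to at least one pendant vertex. $S_p=K_{1,p-1}$ denotes the star on $p$ vertices. The family $\mathcal{T}$ consists of all stars $S_p$ with $p\ge 3$ and all trees $T=T_k$ that can be obtained from a sequence $T_1,T_2,\dots,T_k$ in which $T_1$ is a star $S_p$ with $p\ge 3$ and, for $2\le i\le k$, $T_i$ is obtained from $T_{i-1}$ by the operation: attach a copy of a star $S_q$ with $q\ge 3$ by adding an edge joining the center of $S_q$ to a support vertex of $T_{i-1}$. *)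

theory Defs
  imports Complex_Main "Graph_Theory.Graph_Theory"
begin

text \<open>
  Finite simple graphs are represented by \<^locale>\<open>pair_graph\<close>: finite, loop-free digraphs whose
  arc relation is symmetric, so an edge \<open>uv\<close> is the pair of arcs \<open>(u, v)\<close> and \<open>(v, u)\<close>, and
  the degree of a vertex is its out-degree.
\<close>

text \<open>
  The library predicate \<^const>\<open>tree\<close> is meant for digraphs that contain at most one of the two
  orientations of an edge: walking along an edge and back is already a
  \<^const>\<open>pre_digraph.cycle\<close> of length 2. In a loop-free symmetric digraph the cycles of the
  underlying undirected graph are exactly the directed cycles of length at least 3.
\<close>

definition undirected_tree :: "'a pair_pre_digraph \<Rightarrow> bool" where
  "undirected_tree G \<longleftrightarrow>
     pair_graph G \<and> connected (with_proj G) \<and>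
     \<not> (\<exists>p. pre_digraph.cycle (with_proj G) p \<and> length p \<ge> 3)"

definition pendant_vertices :: "'a pair_pre_digraph \<Rightarrow> 'a set" where
  "pendant_vertices G = {v \<in> pverts G. out_degree (with_proj G) v = 1}"

definition support_vertices :: "'a pair_pre_digraph \<Rightarrow> 'a set" where
  "support_vertices G = {v \<in> pverts G. \<exists>u \<in> pendant_vertices G. (v, u) \<in> parcs G}"

definition closed_nbhd :: "'a pair_pre_digraph \<Rightarrow> 'a \<Rightarrow> 'a set" where
  "closed_nbhd G v = {v} \<union> {u. (u, v) \<in> parcs G}"

text \<open>Only the values of \<open>f\<close> on the vertices of \<open>G\<close> matter.\<close>

definition MRDF :: "'a pair_pre_digraph \<Rightarrow> ('a \<Rightarrow> int) \<Rightarrow> bool" where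
  "MRDF G f \<longleftrightarrow>
     (\<forall>v \<in> pverts G. f v \<in> {-1, 1, 2}) \<and>
     real (card {v \<in> pverts G. (\<Sum>x\<in>closed_nbhd G v. f x) \<ge> 1}) \<ge> real (card (pverts G)) / 2 \<and>
     (\<forall>u \<in> pverts G. f u = -1 \<longrightarrow> (\<exists>w \<in> pverts G. (u, w) \<in> parcs G \<and> f w = 2))"

definition MR_domination_number :: "'a pair_pre_digraph \<Rightarrow> int" where
  "MR_domination_number G = Min {\<Sum>x\<in>pverts G. f x | f. MRDF G f}"

text \<open>The minimum is taken over a finite nonempty set, hence attained.\<close>

lemma finite_MRDF_weights:
  assumes "finite (pverts G)"
  shows "finite {\<Sum>x\<in>pverts G. f x | f. MRDF G f}"
proof (rule finite_subset)
  show "{\<Sum>x\<in>pverts G. f x | f. MRDF G f} \<subseteq> {- int (card (pverts G)) .. 2 * int (card (pverts G))}"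
  proof clarify
    fix f :: "'a \<Rightarrow> int" assume "MRDF G f"
    then have b: "- 1 \<le> f v \<and> f v \<le> 2" if "v \<in> pverts G" for v
      using that by (auto simp: MRDF_def)
    have "(\<Sum>x\<in>pverts G. - 1) \<le> sum f (pverts G)"
      by (rule sum_mono) (use b in blast)
    moreover have "sum f (pverts G) \<le> (\<Sum>x\<in>pverts G. 2)"
      by (rule sum_mono) (use b in blast)
    ultimately show "sum f (pverts G) \<in> {- int (card (pverts G)) .. 2 * int (card (pverts G))}"
      by simp
  qed
qed simp

lemma MRDF_const_1:
  assumes "pair_graph G"
  shows "MRDF G (\<lambda>_. 1)"
proof -
  interpret pair_graph G by fact
  have "finite (closed_nbhd G v)" for v
    unfolding closed_nbhd_def
    by (rule finite_UnI, simp, rule finite_subset[OF _ finite_imageI[OF pair_finite_arcs, of fst]]) force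
  then have "1 \<le> card (closed_nbhd G v)" for v
    by (auto simp: closed_nbhd_def Suc_le_eq card_gt_0_iff)
  then have "{v \<in> pverts G. (\<Sum>x\<in>closed_nbhd G v. 1::int) \<ge> 1} = pverts G"
    by simp
  then show ?thesis by (simp add: MRDF_def)
qed

lemma MR_domination_number_attained:
  assumes "pair_graph G"
  shows "\<exists>f. MRDF G f \<and> MR_domination_number G = (\<Sum>x\<in>pverts G. f x)"
proof -
  interpret pair_graph G by fact
  have "MR_domination_number G \<in> {\<Sum>x\<in>pverts G. f x | f. MRDF G f}"
    unfolding MR_domination_number_def
    using finite_MRDF_weights[OF pair_finite_verts] MRDF_const_1[OF assms]
    by (intro Min_in) auto
  then show ?thesis by blast
qed

definition star_graph :: "'a \<Rightarrow> 'a set \<Rightarrow> 'a pair_pre_digraph" where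
  "star_graph c L = \<lparr> pverts = insert c L, parcs = {c} \<times> L \<union> L \<times> {c} \<rparr>"

definition is_star :: "'a \<Rightarrow> nat \<Rightarrow> 'a pair_pre_digraph \<Rightarrow> bool" where
  "is_star c p S \<longleftrightarrow>
     (\<exists>L. finite L \<and> c \<notin> L \<and> S = star_graph c L) \<and> card (pverts S) = p"

text \<open>
  Centre and leaves of each star are arbitrary elements of the vertex type, so the family is
  closed under isomorphism; disjointness makes the attached star a new copy.
\<close>

inductive_set MR_family :: "'a pair_pre_digraph set" where
  star: "is_star c p S \<Longrightarrow> p \<ge> 3 \<Longrightarrow> S \<in> MR_family"
| attach:
    "\<lbrakk> H \<in> MR_family; w \<in> support_vertices H; is_star c q S; q \<ge> 3; pverts H \<inter> pverts S = {} \<rbrakk>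
     \<Longrightarrow> \<lparr> pverts = pverts H \<union> pverts S,
           parcs = parcs H \<union> parcs S \<union> {(w, c), (c, w)} \<rparr> \<in> MR_family"

end

theory Submission
  imports Defs
begin

text \<open>
  Let \<open>S\<close> be the set of support vertices, \<open>L\<close> the set of pendant vertices and \<open>R\<close> the set of the other
  vertices. Then \<open>n + 7s - 5l = 4(2s - l) + |R|\<close>, and \<open>2s - l\<close> is the weight of the function that is
  2 on \<open>S\<close> and \<open>-1\<close> on \<open>L\<close>. It already makes all closed neighbourhoods of pendant vertices positive.
  The tree belongs to the family iff \<open>R = {}\<close> and every support vertex has at least two pendant
  neighbours; then the weight on each star is minimised separately and \<open>2s - l\<close> is optimal.
  If \<open>R\<close> is nonempty, the function extends to \<open>R\<close> with weight less than \<open>|R|/4\<close> there; if \<open>R = {}\<close>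
  and some support vertex \<open>c\<close> has a single pendant neighbour \<open>x\<close>, changing the values to \<open>-1\<close> at \<open>c\<close>
  and 1 at \<open>x\<close> saves 1.
\<close>

lemma out_degree_with_proj: "out_degree (with_proj G) v = card {u. (v, u) \<in> parcs G}"
proof -
  have "out_arcs (with_proj G) v = Pair v ` {u. (v, u) \<in> parcs G}"
    by (auto simp: out_arcs_def)
  then show ?thesis by (simp add: out_degree_def card_image inj_on_def)
qed

section \<open>Rooted trees\<close>

locale large_tree = pair_graph T for T :: "'a pair_pre_digraph" +
  assumes connected: "connected (with_proj T)"
    and acyclic: "\<And>p. cycle p \<Longrightarrow> length p < 3"
    and order_ge_3: "3 \<le> card (pverts T)"
begin

definition N :: "'a \<Rightarrow> 'a set" where "N v = {u. (u, v) \<in> parcs T}"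

lemma N_sym: "u \<in> N v \<longleftrightarrow> v \<in> N u"
  using arcs_symmetric by (auto simp: N_def)

lemma not_in_N: "v \<notin> N v"
  using no_loops' by (auto simp: N_def)

lemma N_verts: "u \<in> N v \<Longrightarrow> u \<in> pverts T \<and> v \<in> pverts T"
  using in_arcsD1 in_arcsD2 by (auto simp: N_def)

lemma finite_N [simp]: "finite (N v)"
  using N_verts by (meson finite_subset pair_finite_verts subsetI)

lemma parcs_iff_N: "(u, v) \<in> parcs T \<longleftrightarrow> u \<in> N v"
  by (simp add: N_def)

lemma tree_path:
  assumes "u \<in> pverts T" "v \<in> pverts T"
  shows "(u, v) \<in> (parcs T)\<^sup>*"
proof -
  have "u \<rightarrow>\<^sup>*\<^bsub>mk_symmetric (with_proj T)\<^esub> v"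
    using connected assms by (auto simp: connected_def strongly_connected_def)
  then have "u \<rightarrow>\<^sup>*\<^bsub>with_proj T\<^esub> v"
    using reachable_mk_symmetric_eq[OF pair_sym_arcs] by simp
  then show ?thesis
    using reachable_rtranclI by fastforce
qed

text \<open>Prefixing the arc \<open>(u, v)\<close> to a path from \<open>v\<close> to
  \<open>u\<close> inside \<open>p\<close> gives a cycle. Cycles have length less than 3, so that
  path can only be the single arc \<open>(v, u)\<close>.\<close>

lemma edge_not_bypassed:
  assumes "awalk v p u" and "u \<in> N v"
  shows "(u, v) \<in> set p \<or> (v, u) \<in> set p"
proof (rule ccontr)
  assume avoid: "\<not> ?thesis"
  define r where "r = awalk_to_apath p"
  have r: "apath v r u" "set r \<subseteq> set p"
    using assms(1) apath_awalk_to_apath awalk_to_apath_subset by (auto simp: r_def)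
  have "u \<noteq> v" using assms(2) not_in_N by auto
  have "awalk u ((u, v) # r) u" "distinct (pawalk_verts v r)"
    using r(1) assms(2) by (auto simp: apath_def awalk_Cons_iff parcs_iff_N)
  then have "cycle ((u, v) # r)"
    unfolding cycle_def by auto
  then have "length r < 2" using acyclic by fastforce
  then consider "r = []" | a where "r = [a]"
    by (cases r; cases "tl r") auto
  then show False
  proof cases
    case 1
    then show False using r(1) \<open>u \<noteq> v\<close> by (auto simp: apath_Nil_iff)
  next
    case 2
    then have "a = (v, u)"
      using r(1) by (cases a) (auto simp: apath_simps)
    then show False using 2 r(2) avoid by auto
  qed
qed

text \<open>\<open>dep\<close> is the distance from the root, and the parent precedes its vertex on
  a shortest walk. For the second property, the walks along parent edges from both ends of an edge
  to the root are joined. By \<open>edge_not_bypassed\<close> they contain that edge, which is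
  therefore a parent edge.\<close>

lemma rooted:
  assumes root: "\<rho> \<in> pverts T"
  obtains par :: "'a \<Rightarrow> 'a" and dep :: "'a \<Rightarrow> nat"
  where "\<And>v. v \<in> pverts T \<Longrightarrow> v \<noteq> \<rho> \<Longrightarrow> par v \<in> N v \<and> dep v = Suc (dep (par v))"
    and "\<And>u v. u \<in> N v \<Longrightarrow> (u \<noteq> \<rho> \<and> v = par u) \<or> (v \<noteq> \<rho> \<and> u = par v)"
proof -
  define dep where "dep v = (LEAST k. (\<rho>, v) \<in> parcs T ^^ k)" for v
  define par where "par v = (SOME u. u \<in> N v \<and> dep v = Suc (dep u))" for v
  have dep: "(\<rho>, v) \<in> parcs T ^^ dep v" if "v \<in> pverts T" for v
    using tree_path[OF root that] unfolding dep_def rtrancl_power by (auto intro: LeastI)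
  have par: "par v \<in> N v \<and> dep v = Suc (dep (par v))" if v: "v \<in> pverts T" "v \<noteq> \<rho>" for v
  proof -
    obtain k where k: "dep v = Suc k"
      using dep[OF v(1)] v(2) by (cases "dep v") auto
    obtain u where u: "(\<rho>, u) \<in> parcs T ^^ k" "(u, v) \<in> parcs T"
      using dep[OF v(1)] k by auto
    have "dep u \<le> k" unfolding dep_def by (rule Least_le) (rule u(1))
    moreover have "dep v \<le> Suc (dep u)"
      unfolding dep_def[of v]
      by (rule Least_le) (use u dep[of u] in_arcsD1 in auto)
    ultimately have "u \<in> N v \<and> dep v = Suc (dep u)"
      using u k by (auto simp: N_def)
    then show ?thesis unfolding par_def by (rule someI)
  qed
  define P where "P = {(u, v). (u \<noteq> \<rho> \<and> v = par u) \<or> (v \<noteq> \<rho> \<and> u = par v)}"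
  have up: "\<exists>p. awalk v p \<rho> \<and> set p \<subseteq> P" if "v \<in> pverts T" for v
    using that
  proof (induction "dep v" arbitrary: v rule: less_induct)
    case less
    show ?case
    proof (cases "v = \<rho>")
      case True
      then show ?thesis using root by (intro exI[of _ "[]"]) (auto simp: awalk_Nil_iff)
    next
      case False
      obtain p where "awalk (par v) p \<rho>" "set p \<subseteq> P"
        using less(1)[of "par v"] par[OF less(2) False] N_verts by auto
      then show ?thesis
        using par[OF less(2) False] False N_sym
        by (intro exI[of _ "(v, par v) # p"]) (auto simp: awalk_Cons_iff parcs_iff_N P_def)
    qed
  qed
  have "(u, v) \<in> P" if uv: "u \<in> N v" for u v
  proof -
    obtain p q where pq: "awalk v p \<rho>" "set p \<subseteq> P" "awalk u q \<rho>" "set q \<subseteq> P"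
      using up uv N_verts by meson
    have "awalk \<rho> (rev_path q) u" using pq(3) by simp
    then have "awalk v (p @ rev_path q) u" using pq(1) by (meson awalk_appendI)
    then have "(u, v) \<in> set (p @ rev_path q) \<or> (v, u) \<in> set (p @ rev_path q)"
      using edge_not_bypassed uv by blast
    moreover have "set (rev_path q) \<subseteq> P"
      using pq(4) by (induction q) (auto simp: P_def)
    ultimately show ?thesis using pq(2) by (auto simp: P_def)
  qed
  then show thesis using that[of par dep] par by (auto simp: P_def)
qed

end

section \<open>Pendant and support vertices\<close>

context large_tree
begin

abbreviation "S \<equiv> support_vertices T"
abbreviation "L \<equiv> pendant_vertices T"

definition "R = pverts T - S - L"

lemma out_degree_eq: "out_degree (with_proj T) v = card (N v)"
proof -
  have "{u. (v, u) \<in> parcs T} = N v" using N_sym by (auto simp: parcs_iff_N)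
  then show ?thesis by (simp add: out_degree_with_proj)
qed

lemma mem_L: "v \<in> L \<longleftrightarrow> v \<in> pverts T \<and> card (N v) = 1"
  by (simp add: pendant_vertices_def out_degree_eq)

lemma mem_S: "v \<in> S \<longleftrightarrow> N v \<inter> L \<noteq> {}"
  using N_verts N_sym by (auto simp: support_vertices_def parcs_iff_N)

lemma L_verts: "L \<subseteq> pverts T" and S_verts: "S \<subseteq> pverts T" and R_verts: "R \<subseteq> pverts T"
  by (auto simp: pendant_vertices_def support_vertices_def R_def)

lemma finite_L [simp]: "finite L" and finite_S [simp]: "finite S" and finite_R [simp]: "finite R"
  using L_verts S_verts R_verts pair_finite_verts by (blast intro: finite_subset)+

text \<open>Rooting the tree at another vertex makes the parent of \<open>v\<close> a
  neighbour.\<close>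

lemma N_nonempty:
  assumes v: "v \<in> pverts T"
  shows "N v \<noteq> {}"
proof -
  have "\<not> pverts T \<subseteq> {v}"
    using card_mono[of "{v}" "pverts T"] order_ge_3 by auto
  then obtain w where w: "w \<in> pverts T" "v \<noteq> w" by auto
  obtain par :: "'a \<Rightarrow> 'a" where "par v \<in> N v"
    by (rule rooted[OF w(1)]) (use v w(2) in blast)
  then show ?thesis by auto
qed

text \<open>Two adjacent pendant vertices form a whole component, so the connected tree would have
  order 2.\<close>

lemma S_L_disjoint: "S \<inter> L = {}"
proof (rule ccontr)
  assume "S \<inter> L \<noteq> {}"
  then obtain v where v: "v \<in> S" "v \<in> L" by auto
  then obtain u where u: "N v = {u}" "u \<in> L"
    by (auto simp: mem_S mem_L card_1_singleton_iff)
  moreover have "v \<in> N u" using u(1) N_sym by auto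
  ultimately have Nu: "N u = {v}" by (auto simp: mem_L card_1_singleton_iff)
  obtain par dep where par: "\<And>w. w \<in> pverts T \<Longrightarrow> w \<noteq> v \<Longrightarrow> par w \<in> N w \<and> dep w = Suc (dep (par w))"
    by (rule rooted[of v]) (use v(2) L_verts in auto)
  \<comment> \<open>Induction on the depth below the root \<open>v\<close>: a vertex whose parent is
    in \<open>{u, v}\<close> is a neighbour of \<open>u\<close> or \<open>v\<close>, hence again in
    that set.\<close>
  have "w \<in> {u, v}" if "w \<in> pverts T" for w
    using that
  proof (induction "dep w :: nat" arbitrary: w rule: less_induct)
    case less
    show ?case
    proof (cases "w = v")
      case False
      have "par w \<in> {u, v}" using less(1)[of "par w"] par[OF less(2) False] N_verts by auto
      moreover have "w \<in> N (par w)" using par[OF less(2) False] N_sym by blast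
      ultimately show ?thesis using u(1) Nu by auto
    qed auto
  qed
  then have "card (pverts T) \<le> card {u, v}" by (intro card_mono) auto
  also have "\<dots> \<le> 2" by (simp add: card_insert_if)
  finally show False using order_ge_3 by simp
qed

lemma pendant_nbr:
  assumes "v \<in> L"
  obtains c where "N v = {c}" "c \<in> S"
proof -
  obtain c where "N v = {c}" using assms by (auto simp: mem_L card_1_singleton_iff)
  moreover have "v \<in> N c" using calculation N_sym by auto
  ultimately show thesis using that assms mem_S by blast
qed

lemma card_N_ge_2:
  assumes "v \<in> pverts T" "v \<notin> L"
  shows "2 \<le> card (N v)"
proof -
  have "card (N v) \<noteq> 0" using N_nonempty[OF assms(1)] by simp
  moreover have "card (N v) \<noteq> 1" using assms mem_L by auto
  ultimately show ?thesis by linarith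
qed

lemma R_nbrs:
  assumes "v \<in> R"
  shows "N v \<subseteq> S \<union> R" "2 \<le> card (N v)"
proof -
  have "N v \<inter> L = {}" using assms mem_S by (auto simp: R_def)
  then show "N v \<subseteq> S \<union> R" using N_verts by (auto simp: R_def)
  show "2 \<le> card (N v)" using assms card_N_ge_2 by (auto simp: R_def)
qed

lemma N_L_disjoint:
  assumes "c \<noteq> d"
  shows "N c \<inter> L \<inter> (N d \<inter> L) = {}"
proof (rule ccontr)
  assume "\<not> ?thesis"
  then obtain v where v: "v \<in> L" "c \<in> N v" "d \<in> N v" using N_sym by blast
  then show False using assms by (metis pendant_nbr singletonD)
qed

lemma L_eq_UN: "L = (\<Union>c\<in>S. N c \<inter> L)"
proof -
  have "\<exists>c\<in>S. v \<in> N c" if "v \<in> L" for v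
    using pendant_nbr[OF that] N_sym by (metis singletonI)
  then show ?thesis by auto
qed

lemma sum_L: "(\<Sum>v\<in>L. g v) = (\<Sum>c\<in>S. \<Sum>v\<in>N c \<inter> L. g v)"
proof -
  have "(\<Sum>v\<in>(\<Union>c\<in>S. N c \<inter> L). g v) = (\<Sum>c\<in>S. \<Sum>v\<in>N c \<inter> L. g v)"
    by (rule sum.UNION_disjoint) (use N_L_disjoint in auto)
  then show ?thesis using L_eq_UN by simp
qed

text \<open>Every support vertex has pendant neighbours of its own. The inequality makes
  \<open>L\<close> at least half of \<open>S \<union> L\<close>, as the majority condition
  demands.\<close>

lemma card_S_le_L: "card S \<le> card L"
proof -
  have "(\<Sum>c\<in>S. 1) \<le> (\<Sum>c\<in>S. card (N c \<inter> L))"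
    by (rule sum_mono) (simp add: Suc_le_eq card_gt_0_iff mem_S)
  then show ?thesis using sum_L[of "\<lambda>_. 1 :: nat"] by simp
qed

lemma sum_verts: "(\<Sum>v\<in>pverts T. g v) = (\<Sum>v\<in>S. g v) + (\<Sum>v\<in>L. g v) + (\<Sum>v\<in>R. g v)"
  for g :: "'a \<Rightarrow> 'b::comm_monoid_add"
proof -
  have "pverts T = S \<union> L \<union> R" using L_verts S_verts by (auto simp: R_def)
  moreover have "(S \<union> L) \<inter> R = {}" by (auto simp: R_def)
  ultimately show ?thesis using S_L_disjoint by (simp add: sum.union_disjoint)
qed

lemma card_verts: "card (pverts T) = card S + card L + card R"
  using sum_verts[of "\<lambda>_. 1 :: nat"] by simp

section \<open>Weights of dominating functions, and the vertices in \<open>R\<close>\<close>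

lemma sum_closed_nbhd: "(\<Sum>x\<in>closed_nbhd T v. f x) = f v + (\<Sum>x\<in>N v. f x)"
  for f :: "'a \<Rightarrow> int"
proof -
  have "closed_nbhd T v = insert v (N v)" by (auto simp: closed_nbhd_def N_def)
  then show ?thesis using not_in_N by simp
qed

text \<open>\<open>A\<close> is a set of witnesses for the majority condition, so the exact set of
  positive neighbourhoods is never computed.\<close>

lemma MRDF_intro:
  assumes "\<And>v. v \<in> pverts T \<Longrightarrow> f v \<in> {-1, 1, 2}"
    and "A \<subseteq> pverts T" "card (pverts T) \<le> 2 * card A"
    and "\<And>v. v \<in> A \<Longrightarrow> 1 \<le> f v + (\<Sum>x\<in>N v. f x)"
    and "\<And>v. v \<in> pverts T \<Longrightarrow> f v = -1 \<Longrightarrow> \<exists>w\<in>N v. f w = 2"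
  shows "MRDF T f"
proof -
  have "card A \<le> card {v \<in> pverts T. (\<Sum>x\<in>closed_nbhd T v. f x) \<ge> 1}"
    using assms(2,4) pair_finite_verts by (intro card_mono) (auto simp: sum_closed_nbhd)
  then have "real (card (pverts T)) / 2 \<le> real (card {v \<in> pverts T. (\<Sum>x\<in>closed_nbhd T v. f x) \<ge> 1})"
    using assms(3) by linarith
  then show ?thesis
    unfolding MRDF_def using assms(1,5) N_verts N_sym parcs_iff_N by blast
qed

lemma gamma_le: "MRDF T f \<Longrightarrow> MR_domination_number T \<le> sum f (pverts T)"
  unfolding MR_domination_number_def
  using finite_MRDF_weights[OF pair_finite_verts] by (auto intro: Min_le)

lemma gamma_attained: "\<exists>f. MRDF T f \<and> MR_domination_number T = sum f (pverts T)"
  using MR_domination_number_attained[OF pair_graph] .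

text \<open>
  With 2 on \<open>S\<close> and \<open>-1\<close> on \<open>L\<close>, a vertex of an independent set \<open>X\<close> with value \<open>-1\<close> has at least
  two neighbours, all of positive value, so its closed neighbourhood has positive weight.
\<close>

lemma gamma_le_of_independent:
  assumes X: "X \<subseteq> R" "\<And>u v. u \<in> X \<Longrightarrow> v \<in> X \<Longrightarrow> u \<notin> N v" "card R \<le> 2 * card X"
    and D: "D \<subseteq> R - X" "\<And>v. v \<in> X \<Longrightarrow> N v \<inter> (S \<union> D) \<noteq> {}"
  shows "MR_domination_number T
    \<le> 2 * int (card S) - int (card L) + (int (card D) + int (card R) - 2 * int (card X))"
proof -
  \<comment> \<open>The value 2 on \<open>D\<close> defends the vertices of \<open>X\<close> without
    a neighbour in \<open>S\<close>; the rest of \<open>R\<close> gets 1.\<close>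
  define f :: "'a \<Rightarrow> int"
    where "f v = (if v \<in> L \<union> X then -1 else if v \<in> S \<union> D then 2 else 1)" for v
  have fS: "f v = 2" if "v \<in> S" for v
    using that X(1) S_L_disjoint by (auto simp: f_def R_def)
  have fL: "f v = -1" if "v \<in> L" for v using that by (simp add: f_def)
  have fD: "f v = 2" if "v \<in> D" for v using that D(1) by (auto simp: f_def R_def)
  have "MRDF T f"
  proof (rule MRDF_intro[where A = "L \<union> X"])
    have "card (L \<union> X) = card L + card X"
      using X(1) finite_subset[OF X(1)] by (intro card_Un_disjoint) (auto simp: R_def)
    then show "card (pverts T) \<le> 2 * card (L \<union> X)"
      using card_verts card_S_le_L X(3) by linarith
  next
    fix v assume "v \<in> L \<union> X"
    then consider "v \<in> L" | "v \<in> X" by auto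
    then show "1 \<le> f v + (\<Sum>x\<in>N v. f x)"
    proof cases
      case 1
      then show ?thesis by (metis pendant_nbr fL fS sum.insert_remove sum.empty finite.emptyI
            empty_Diff add_0_right one_add_one add_diff_cancel_left' uminus_add_conv_diff order_refl)
    next
      case 2
      have "1 \<le> f x" if "x \<in> N v" for x
      proof -
        have "x \<in> S \<union> R" using that 2 X(1) R_nbrs(1)[of v] by auto
        then have "x \<notin> L \<union> X" using that 2 X(2) S_L_disjoint by (auto simp: R_def)
        then show ?thesis by (simp add: f_def)
      qed
      then have "(\<Sum>x\<in>N v. 1) \<le> (\<Sum>x\<in>N v. f x)" by (rule sum_mono)
      moreover have "2 \<le> card (N v)" using 2 X(1) R_nbrs(2) by auto
      ultimately show ?thesis using 2 by (simp add: f_def)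
    qed
  next
    fix v assume "v \<in> pverts T" "f v = -1"
    then consider "v \<in> L" | "v \<in> X" by (auto simp: f_def split: if_splits)
    then show "\<exists>w\<in>N v. f w = 2"
    proof cases
      case 1
      then show ?thesis by (metis pendant_nbr fS singletonI)
    next
      case 2
      then show ?thesis using D(2) fS fD by blast
    qed
  qed (use X(1) L_verts R_verts in \<open>auto simp: f_def\<close>)
  moreover have "sum f (pverts T)
    = 2 * int (card S) - int (card L) + (int (card D) + int (card R) - 2 * int (card X))"
  proof -
    have "sum f R = (\<Sum>v\<in>R. 1 + (if v \<in> D then 1 else 0) - (if v \<in> X then 2 else 0))"
      using D(1) by (intro sum.cong) (auto simp: f_def R_def)
    also have "\<dots> = int (card R) + int (card (R \<inter> D)) - 2 * int (card (R \<inter> X))"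
      by (simp add: sum.distrib sum_subtractf flip: sum.inter_restrict)
    also have "R \<inter> D = D" using D(1) by auto
    also have "R \<inter> X = X" using X(1) by auto
    finally show ?thesis using fS fL by (simp add: sum_verts)
  qed
  ultimately show ?thesis using gamma_le by metis
qed

text \<open>Root the tree inside \<open>R\<close>. A deepest vertex of \<open>R\<close> has no child
  in \<open>R\<close>, so at most its parent is a neighbour in \<open>R\<close>. It has at least two
  neighbours, all in \<open>S \<union> R\<close>, so one is in \<open>S\<close>.\<close>

lemma R_leaf:
  assumes "R \<noteq> {}"
  obtains r \<rho> where "r \<in> R" "\<rho> \<in> S" "\<rho> \<in> N r" "card (N r \<inter> R) \<le> 1"
proof -
  obtain x where x: "x \<in> R" using assms by auto
  obtain par dep where par: "\<And>v. v \<in> pverts T \<Longrightarrow> v \<noteq> x \<Longrightarrow> par v \<in> N v \<and> dep v = Suc (dep (par v))"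
    and edge: "\<And>u v. u \<in> N v \<Longrightarrow> (u \<noteq> x \<and> v = par u) \<or> (v \<noteq> x \<and> u = par v)"
    using rooted[of x] x R_verts by blast
  obtain r where r: "r \<in> R" "\<And>v. v \<in> R \<Longrightarrow> dep v \<le> (dep r :: nat)"
    using Max_in[of "dep ` R"] Max_ge[of "dep ` R"] assms by fastforce
  have "N r \<inter> R \<subseteq> {par r}"
  proof
    fix u assume u: "u \<in> N r \<inter> R"
    have "\<not> (u \<noteq> x \<and> r = par u)"
      using par[of u] r(2)[of u] u N_verts[of u r] by auto
    then show "u \<in> {par r}" using edge[of u r] u by auto
  qed
  then have le: "card (N r \<inter> R) \<le> 1"
    using card_mono[of "{par r}" "N r \<inter> R"] by simp
  then have "\<not> N r \<subseteq> R"
    using R_nbrs(2)[OF r(1)] by (auto simp: Int_absorb2)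
  then obtain \<rho> where "\<rho> \<in> N r" "\<rho> \<in> S" using R_nbrs(1)[OF r(1)] by auto
  then show thesis using that r(1) le by blast
qed

text \<open>
  Root the tree at \<open>\<rho>\<close> and let \<open>top v\<close> be the depth of \<open>v\<close> inside its component of \<open>R\<close>. If \<open>X\<close> is a
  parity class and \<open>D\<close> is one residue class modulo 4 of the other parity, then every \<open>v \<in> X\<close> not
  adjacent to \<open>S\<close> has its parent or its children in \<open>D\<close>. Taking \<open>X\<close> to be the larger parity class
  and \<open>D\<close> the smaller half of the other gives the last inequality, except when all four residue
  classes have the same size. Then exchanging the root \<open>r\<close> with its at most one neighbour in \<open>R\<close>
  keeps \<open>X\<close> independent and makes \<open>D\<close> smaller.
\<close>

lemma independent_set:
  assumes "R \<noteq> {}"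
  obtains X D where "X \<subseteq> R" "\<And>u v. u \<in> X \<Longrightarrow> v \<in> X \<Longrightarrow> u \<notin> N v" "card R \<le> 2 * card X"
    "D \<subseteq> R - X" "\<And>v. v \<in> X \<Longrightarrow> N v \<inter> (S \<union> D) \<noteq> {}"
    "4 * card D + 3 * card R < 8 * card X"
proof -
  note result = that
  obtain r \<rho> where r: "r \<in> R" "\<rho> \<in> S" "\<rho> \<in> N r" "card (N r \<inter> R) \<le> 1"
    using R_leaf[OF assms] .
  obtain par dep where par: "\<And>v. v \<in> pverts T \<Longrightarrow> v \<noteq> \<rho> \<Longrightarrow> par v \<in> N v \<and> dep v = Suc (dep (par v) :: nat)"
    and edge: "\<And>u v. u \<in> N v \<Longrightarrow> (u \<noteq> \<rho> \<and> v = par u) \<or> (v \<noteq> \<rho> \<and> u = par v)"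
    using rooted[of \<rho>] r(2) S_verts by blast
  have not_root: "v \<noteq> \<rho>" if "v \<in> R" for v using that r(2) by (auto simp: R_def)
  \<comment> \<open>The count starts at the parent: \<open>top v\<close> is 0 if the parent is in
    \<open>S\<close>. The way up from \<open>R\<close> does meet \<open>S\<close>, since it leaves
    \<open>R\<close> at a member of \<open>S\<close> or reaches the root, which is in
    \<open>S\<close>.\<close>
  define top where "top v = (LEAST k. (par ^^ Suc k) v \<in> S)" for v
  have ex_top: "\<exists>k. (par ^^ Suc k) v \<in> S" if "v \<in> R" for v
    using that
  proof (induction "dep v" arbitrary: v rule: less_induct)
    case less
    have v: "par v \<in> N v" "dep v = Suc (dep (par v))"
      using par[of v] less(2) not_root R_verts by auto
    show ?case
    proof (cases "par v \<in> S")
      case True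
      then show ?thesis by (intro exI[of _ 0]) simp
    next
      case False
      then obtain k where "(par ^^ Suc k) (par v) \<in> S"
        using less(1)[of "par v"] v R_nbrs(1)[OF less(2)] by auto
      then show ?thesis by (metis funpow_Suc_right o_apply)
    qed
  qed
  have top_0: "top v = 0" if "par v \<in> S" for v
    unfolding top_def by (rule Least_eq_0) (use that in simp)
  have top_Suc: "top v = Suc (top (par v))" if v: "v \<in> R" "par v \<in> R" for v
  proof -
    have "par v \<notin> S" using v(2) by (auto simp: R_def)
    moreover obtain k where "(par ^^ Suc k) v \<in> S" using ex_top[OF v(1)] by blast
    ultimately show ?thesis
      using Least_Suc[of "\<lambda>k. (par ^^ Suc k) v \<in> S" k]
      by (simp add: top_def del: funpow.simps add: funpow_Suc_right)
  qed
  have adj: "top u = Suc (top v) \<or> top v = Suc (top u)" if "u \<in> N v" "u \<in> R" "v \<in> R" for u v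
    using edge[OF that(1)] top_Suc that(2,3) by auto
  have up: "\<exists>u\<in>N v \<inter> R. top v = Suc (top u)" if v: "v \<in> R" "N v \<inter> S = {}" for v
  proof -
    have "par v \<in> N v" using par[of v] v not_root R_verts by auto
    moreover have "par v \<in> R" using calculation R_nbrs(1)[OF v(1)] v(2) by auto
    ultimately show ?thesis using top_Suc[OF v(1)] by auto
  qed
  have down: "\<exists>u\<in>N v \<inter> R. top u = Suc (top v)" if v: "v \<in> R" "N v \<inter> S = {}" for v
  proof -
    \<comment> \<open>Degree at least two yields a neighbour other than the parent, that is, a
      child.\<close>
    have "\<not> N v \<subseteq> {par v}"
      using card_mono[of "{par v}" "N v"] R_nbrs(2)[OF v(1)] by auto
    then obtain u where u: "u \<in> N v" "u \<noteq> par v" by auto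
    then have "u \<in> R" "v = par u" using R_nbrs(1)[OF v(1)] v(2) edge by auto
    then show ?thesis using u top_Suc[of u] v(1) by auto
  qed
  define C where "C i = {v \<in> R. top v mod 4 = i}" for i
  have C_fin: "finite (C i)" for i unfolding C_def by simp
  have C_R: "C i \<subseteq> R" for i unfolding C_def by auto
  have C_disj: "C i \<inter> C j = {}" if "i \<noteq> j" for i j using that by (auto simp: C_def)
  have R_eq: "R = C 0 \<union> C 1 \<union> C 2 \<union> C 3"
    by (auto simp: C_def)
  have card_R: "card R = card (C 0 \<union> C 2) + card (C 1 \<union> C 3)"
  proof -
    have "R = (C 0 \<union> C 2) \<union> (C 1 \<union> C 3)" using R_eq by auto
    moreover have "(C 0 \<union> C 2) \<inter> (C 1 \<union> C 3) = {}" using C_disj by (simp add: Int_Un_distrib Int_Un_distrib2)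
    ultimately show ?thesis using C_fin card_Un_disjoint by (metis finite_UnI)
  qed
  have card2: "card (C i \<union> C j) = card (C i) + card (C j)" if "i \<noteq> j" for i j
    using C_disj[OF that] C_fin by (simp add: card_Un_disjoint)
  have cross: "u \<notin> N v" if "u \<in> C i \<union> C k" "v \<in> C i \<union> C k" "i < 2" "k = i + 2" for u v i k
  proof
    assume "u \<in> N v"
    then have "top u = Suc (top v) \<or> top v = Suc (top u)" using adj that C_R by blast
    moreover have "top w mod 2 = i" if "w \<in> C i \<union> C k" for w
      using that \<open>i < 2\<close> \<open>k = i + 2\<close> mod_mod_cancel[of 2 4 "top w"] by (auto simp: C_def)
    ultimately show False
      using that(1,2) by (metis even_Suc even_iff_mod_2_eq_zero)
  qed
  \<comment> \<open>Without neighbours in \<open>S\<close>, \<open>v\<close> has a parent and a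
    child in \<open>R\<close>; their residues are \<open>i + 3\<close> and \<open>i + 1\<close>
    modulo 4, and one of these is \<open>j\<close>.\<close>
  have dom: "N v \<inter> (S \<union> C j) \<noteq> {}" if v: "v \<in> C i" and j: "(i + 1) mod 4 = j \<or> (i + 3) mod 4 = j" for v i j
  proof (cases "N v \<inter> S = {}")
    case True
    obtain u w where u: "u \<in> N v \<inter> R" "top v = Suc (top u)" and w: "w \<in> N v \<inter> R" "top w = Suc (top v)"
      using up[of v] down[of v] v C_R True by blast
    have i: "top v mod 4 = i" using v by (simp add: C_def)
    have "top w mod 4 = (i + 1) mod 4"
      by (subst i[symmetric]) (simp add: w(2) mod_simps)
    moreover have "top u mod 4 = (i + 3) mod 4"
      by (subst i[symmetric]) (simp add: u(2) mod_simps)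
    ultimately have "top u mod 4 = j \<or> top w mod 4 = j" using j by auto
    then show ?thesis using u w by (auto simp: C_def)
  qed auto
  \<comment> \<open>The choice \<open>X = C i \<union> C k\<close> and \<open>D = C j\<close>, where
    \<open>odd (i + j)\<close> puts \<open>D\<close> into the other parity class.\<close>
  have parity: thesis
    if P: "i < 2" "k = i + 2" "card R \<le> 2 * card (C i \<union> C k)" "j < 4" "odd (i + j)"
      "4 * card (C j) + 3 * card R < 8 * card (C i \<union> C k)" for i k j
  proof (rule result)
    show "C j \<subseteq> R - (C i \<union> C k)"
      using C_R C_disj[of j i] C_disj[of j k] P(2,5) by fastforce
    fix v assume "v \<in> C i \<union> C k"
    then obtain h where h: "h = i \<or> h = i + 2" "v \<in> C h" using P(2) by auto
    have "i \<in> {0, 1}" "j \<in> {0, 1, 2, 3}" using P(1,4) by auto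
    then have "(h + 1) mod 4 = j \<or> (h + 3) mod 4 = j"
      using h(1) P(5) by auto
    then show "N v \<inter> (S \<union> C j) \<noteq> {}"
      by (rule dom[OF h(2)])
  next
    show "u \<notin> N v" if "u \<in> C i \<union> C k" "v \<in> C i \<union> C k" for u v
      using cross that P(1,2) by blast
  qed (use P C_R in auto)
  \<comment> \<open>Let \<open>a\<close> and \<open>b\<close> be the sizes of the parity classes
    used for \<open>X\<close> and \<open>D\<close>, so \<open>card R = a + b\<close>. If
    \<open>card D \<le> b / 2\<close>, the required inequality follows from
    \<open>3 a + 5 b < 8 a\<close>, that is, from \<open>b < a\<close>. For \<open>a = b\<close> the
    size of \<open>D\<close> must be strictly below \<open>a / 2\<close>: \<open>C 2\<close>
    achieves this in \<open>tie2\<close>, and \<open>C 0\<close> without \<open>r\<close> in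
    \<open>tie0\<close>.\<close>
  consider (odd) "card (C 0 \<union> C 2) < card (C 1 \<union> C 3)"
    | (even) "card (C 1 \<union> C 3) < card (C 0 \<union> C 2)"
    | (tie2) "card (C 0 \<union> C 2) = card (C 1 \<union> C 3)" "card (C 2) < card (C 0)"
    | (tie0) "card (C 0 \<union> C 2) = card (C 1 \<union> C 3)" "card (C 0) \<le> card (C 2)"
    by linarith
  then show thesis
  proof cases
    case odd
    have "2 * card (C 0) \<le> card (C 0 \<union> C 2) \<or> 2 * card (C 2) \<le> card (C 0 \<union> C 2)"
      using card2[of 0 2] by auto
    then show thesis
    proof
      assume "2 * card (C 0) \<le> card (C 0 \<union> C 2)"
      then show thesis using odd card_R by (intro parity[of 1 3 0]) simp_all
    next
      assume "2 * card (C 2) \<le> card (C 0 \<union> C 2)"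
      then show thesis using odd card_R by (intro parity[of 1 3 2]) simp_all
    qed
  next
    case even
    have "2 * card (C 1) \<le> card (C 1 \<union> C 3) \<or> 2 * card (C 3) \<le> card (C 1 \<union> C 3)"
      using card2[of 1 3] by auto
    then show thesis
    proof
      assume "2 * card (C 1) \<le> card (C 1 \<union> C 3)"
      then show thesis using even card_R by (intro parity[of 0 2 1]) simp_all
    next
      assume "2 * card (C 3) \<le> card (C 1 \<union> C 3)"
      then show thesis using even card_R by (intro parity[of 0 2 3]) simp_all
    qed
  next
    case tie2
    then show thesis
      using card_R card2[of 0 2] by (intro parity[of 1 3 2]) simp_all
  next
    case tie0
    have "par r = \<rho>" using edge[OF r(3)] by simp
    have r0: "r \<in> C 0" using top_0[of r] r(1,2) \<open>par r = \<rho>\<close> by (simp add: C_def)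
    show ?thesis
    proof (rule result)
      let ?O = "C 1 \<union> C 3"
      \<comment> \<open>At most one vertex of \<open>?O\<close> is a neighbour of \<open>r\<close>,
        so \<open>?X\<close> is no smaller than \<open>?O\<close>. Removing \<open>r\<close> from
        \<open>D\<close> leaves the rest of \<open>?X\<close> dominated, as none of it is adjacent
        to \<open>r\<close>; \<open>r\<close> itself is adjacent to \<open>\<rho>\<close> in
        \<open>S\<close>.\<close>
      let ?X = "insert r (?O - N r)" and ?D = "C 0 - {r}"
      have "r \<notin> ?O" using r0 C_disj[of 0 1] C_disj[of 0 3] by auto
      moreover have "card ?O \<le> card (?O - N r) + card (N r \<inter> R)"
      proof -
        have "card ?O \<le> card ((?O - N r) \<union> (N r \<inter> R))"
          using C_R C_fin by (intro card_mono) auto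
        then show ?thesis using card_Un_le order_trans by blast
      qed
      ultimately have X: "card ?O \<le> card ?X" using r(4) C_fin by simp
      then show "card R \<le> 2 * card ?X" using tie0 card_R by linarith
      have "card (C 0) = Suc (card ?D)" using r0 C_fin by (metis card_Suc_Diff1)
      then show "4 * card ?D + 3 * card R < 8 * card ?X"
        using X tie0 card_R card2[of 0 2] by simp
      show "?X \<subseteq> R" using r(1) C_R by auto
      show "?D \<subseteq> R - ?X" using C_R C_disj[of 0 1] C_disj[of 0 3] by auto
      have "u \<notin> N v" if "u \<in> ?O" "v \<in> ?O" for u v
        by (rule cross[OF that]) simp_all
      then show "u \<notin> N v" if "u \<in> ?X" "v \<in> ?X" for u v
        using that not_in_N N_sym by blast
      show "N v \<inter> (S \<union> ?D) \<noteq> {}" if v: "v \<in> ?X" for v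
      proof (cases "v = r")
        case True
        then show ?thesis using r(2,3) by auto
      next
        case False
        then have "r \<notin> N v" using v N_sym by auto
        moreover have "N v \<inter> (S \<union> C 0) \<noteq> {}"
          using False v dom[of v 1 0] dom[of v 3 0] C_R by auto
        ultimately show ?thesis by auto
      qed
    qed
  qed
qed

text \<open>The inequality \<open>4 * card D + 3 * card R < 8 * card X\<close> says that the weight
  \<open>card D + card R - 2 * card X\<close> on \<open>R\<close> is below a quarter of
  \<open>card R\<close>.\<close>

lemma gamma_lt_of_R:
  assumes "R \<noteq> {}"
  shows "4 * MR_domination_number T < 8 * int (card S) - 4 * int (card L) + int (card R)"
proof -
  obtain X D where XD: "X \<subseteq> R" "\<And>u v. u \<in> X \<Longrightarrow> v \<in> X \<Longrightarrow> u \<notin> N v" "card R \<le> 2 * card X"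
    "D \<subseteq> R - X" "\<And>v. v \<in> X \<Longrightarrow> N v \<inter> (S \<union> D) \<noteq> {}"
    "4 * card D + 3 * card R < 8 * card X"
    using independent_set[OF assms] by metis
  show ?thesis using gamma_le_of_independent[OF XD(1-5)] XD(6) by linarith
qed

section \<open>Trees consisting of support and pendant vertices\<close>

lemma gamma_le_of_no_R:
  assumes "R = {}"
  shows "MR_domination_number T \<le> 2 * int (card S) - int (card L)"
  using gamma_le_of_independent[of "{}" "{}"] assms by simp

text \<open>Not being pendant, \<open>c\<close> has a neighbour in \<open>S\<close>, which keeps
  value 2 and defends \<open>c\<close>. After the change the closed neighbourhood of
  \<open>x\<close> sums to 0, but that of \<open>c\<close> sums to at least 2 and replaces it in the
  majority count.\<close>

lemma gamma_lt_of_single_pendant: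
  assumes R: "R = {}" and c: "c \<in> S" "card (N c \<inter> L) = 1"
  shows "MR_domination_number T < 2 * int (card S) - int (card L)"
proof -
  obtain x where x: "N c \<inter> L = {x}" using c(2) by (auto simp: card_1_singleton_iff)
  have Nc: "N c = insert x (N c \<inter> S)"
    using x N_verts R by (auto simp: R_def)
  have xL: "x \<in> L" using x by blast
  have cL: "c \<notin> L" using c(1) S_L_disjoint by auto
  have xS: "x \<notin> S" using x S_L_disjoint by auto
  have "N c \<noteq> {x}" using card_N_ge_2[of c] c(1) cL S_verts by auto
  then obtain u where u: "u \<in> N c" "u \<in> S" using Nc by auto
  have "u \<noteq> c" using u(1) not_in_N by auto
  define f :: "'a \<Rightarrow> int"
    where "f v = (if v = c then -1 else if v = x then 1 else if v \<in> S then 2 else -1)" for v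
  have fx: "f x = 1" using x cL by (auto simp: f_def)
  have f_pendant: "\<exists>d. N v = {d} \<and> f d = 2" if v: "v \<in> L" "v \<noteq> x" for v
  proof -
    obtain d where d: "N v = {d}" "d \<in> S" using pendant_nbr[OF v(1)] .
    moreover have "d \<noteq> c" using d v x N_sym by blast
    ultimately show ?thesis using xS by (auto simp: f_def)
  qed
  have "MRDF T f"
  proof (rule MRDF_intro[where A = "insert c (L - {x})"])
    have "card (insert c (L - {x})) = card L"
      using xL cL card_Suc_Diff1[of L x] by simp
    then show "card (pverts T) \<le> 2 * card (insert c (L - {x}))"
      using card_verts card_S_le_L R by simp
  next
    fix v assume "v \<in> insert c (L - {x})"
    then consider "v = c" | "v \<in> L" "v \<noteq> x" by auto
    then show "1 \<le> f v + (\<Sum>y\<in>N v. f y)"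
    proof cases
      case 1
      have f2: "f y = 2" if "y \<in> N c \<inter> S" for y using that not_in_N xS by (auto simp: f_def)
      have "(\<Sum>y\<in>N c. f y) = f x + (\<Sum>y\<in>N c \<inter> S. f y)"
        by (subst Nc) (use xS in simp)
      also have "\<dots> = 1 + 2 * int (card (N c \<inter> S))"
        using fx f2 by simp
      finally have "(\<Sum>y\<in>N c. f y) = 1 + 2 * int (card (N c \<inter> S))" .
      moreover have "1 \<le> card (N c \<inter> S)"
        using u by (auto simp: Suc_le_eq card_gt_0_iff)
      ultimately show ?thesis using 1 by (simp add: f_def)
    next
      case 2
      obtain d where "N v = {d}" "f d = 2" using f_pendant[OF 2] by blast
      moreover have "f v = -1" using 2 S_L_disjoint by (auto simp: f_def)
      ultimately show ?thesis by simp
    qed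
  next
    fix v assume v: "v \<in> pverts T" "f v = -1"
    then consider "v = c" | "v \<in> L" "v \<noteq> x"
      using R fx by (auto simp: f_def R_def split: if_splits)
    then show "\<exists>w\<in>N v. f w = 2"
    proof cases
      case 1
      then show ?thesis using u \<open>u \<noteq> c\<close> xS by (auto simp: f_def)
    next
      case 2
      then show ?thesis using f_pendant[OF 2] by auto
    qed
  qed (use c(1) S_verts L_verts in \<open>auto simp: f_def\<close>)
  then have "MR_domination_number T \<le> sum f (pverts T)" by (rule gamma_le)
  also have "\<dots> = sum f S + sum f L" using sum_verts[of f] R by simp
  also have "sum f S = sum f (S - {c}) + f c" using c(1) by (simp add: sum.remove)
  also have "sum f (S - {c}) = (\<Sum>v\<in>S - {c}. 2)"
    by (rule sum.cong) (use xS in \<open>auto simp: f_def\<close>)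
  also have "\<dots> = 2 * int (card S) - 2"
    using c(1) card_Suc_Diff1[of S c] by (simp del: card_Suc_Diff1)
  also have "sum f L = sum f (L - {x}) + f x" using xL by (simp add: sum.remove)
  also have "sum f (L - {x}) = (\<Sum>v\<in>L - {x}. - 1)"
    by (rule sum.cong) (use S_L_disjoint in \<open>auto simp: f_def\<close>)
  also have "\<dots> = 1 - int (card L)"
    using xL card_Suc_Diff1[of L x] by (simp del: card_Suc_Diff1)
  finally show ?thesis using fx by (simp add: f_def)
qed

text \<open>Consider a star with centre \<open>c\<close> and \<open>k \<ge> 2\<close> pendant
  vertices. If \<open>f c = 2\<close>, its weight is at least \<open>2 - k\<close>. Otherwise no
  pendant vertex there can be \<open>-1\<close>, since only \<open>c\<close> could defend it, and
  the weight is at least \<open>k - 1\<close>, which is at least \<open>2 - k\<close>.\<close>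

lemma gamma_ge_of_pendants:
  assumes R: "R = {}" and S: "\<And>c. c \<in> S \<Longrightarrow> 2 \<le> card (N c \<inter> L)"
  shows "2 * int (card S) - int (card L) \<le> MR_domination_number T"
proof -
  obtain f where f: "MRDF T f" "MR_domination_number T = sum f (pverts T)"
    using gamma_attained by auto
  have vals: "f v \<in> {-1, 1, 2}" if "v \<in> pverts T" for v using f(1) that by (auto simp: MRDF_def)
  have star: "2 - int (card (N c \<inter> L)) \<le> f c + (\<Sum>v\<in>N c \<inter> L. f v)" if c: "c \<in> S" for c
  proof (cases "f c = 2")
    case True
    have "(\<Sum>v\<in>N c \<inter> L. - 1) \<le> (\<Sum>v\<in>N c \<inter> L. f v)"
      by (rule sum_mono) (use vals L_verts in force)
    then show ?thesis using True by simp
  next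
    case False
    have "1 \<le> f v" if v: "v \<in> N c \<inter> L" for v
    proof -
      have "N v = {c}" using v N_sym by (metis IntD1 IntD2 pendant_nbr singletonD)
      then have "f v \<noteq> -1"
        using f(1) False v L_verts N_sym parcs_iff_N unfolding MRDF_def by (metis Int_iff singletonD subsetD)
      moreover have "v \<in> pverts T" using v L_verts by blast
      ultimately show ?thesis using vals[of v] by auto
    qed
    then have "(\<Sum>v\<in>N c \<inter> L. 1) \<le> (\<Sum>v\<in>N c \<inter> L. f v)" by (rule sum_mono)
    moreover have "c \<in> pverts T" using c S_verts by blast
    then have "- 1 \<le> f c" using vals[of c] by auto
    ultimately show ?thesis using S[OF c] by simp
  qed
  have "2 * int (card S) - int (card L) = (\<Sum>c\<in>S. 2 - int (card (N c \<inter> L)))"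
    using sum_L[of "\<lambda>_. 1 :: int"] by (simp add: sum_subtractf)
  also have "\<dots> \<le> (\<Sum>c\<in>S. f c + (\<Sum>v\<in>N c \<inter> L. f v))"
    by (rule sum_mono) (rule star)
  also have "\<dots> = sum f (pverts T)"
    using sum_verts[of f] sum_L[of f] R by (simp add: sum.distrib)
  finally show ?thesis using f(2) by simp
qed

end

section \<open>The family\<close>

text \<open>The centres \<open>C\<close> and leaves \<open>A\<close> of the stars from which a member of the family is assembled.\<close>

definition star_assembly :: "'a pair_pre_digraph \<Rightarrow> 'a set \<Rightarrow> 'a set \<Rightarrow> bool" where
  "star_assembly G C A \<longleftrightarrow>
     pverts G = C \<union> A \<and> C \<inter> A = {} \<and> finite (C \<union> A) \<and> parcs G \<subseteq> pverts G \<times> pverts G \<and>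
     (\<forall>x\<in>A. \<exists>c\<in>C. {u. (x, u) \<in> parcs G} = {c}) \<and>
     (\<forall>c\<in>C. 2 \<le> card {x \<in> A. (c, x) \<in> parcs G})"

lemma star_assembly_pendant:
  assumes "star_assembly G C A"
  shows "pendant_vertices G = A"
proof -
  have "out_degree (with_proj G) c \<noteq> 1" if c: "c \<in> C" for c
  proof -
    have "{u. (c, u) \<in> parcs G} \<subseteq> C \<union> A" using assms by (auto simp: star_assembly_def)
    then have "finite {u. (c, u) \<in> parcs G}"
      using assms finite_subset by (auto simp: star_assembly_def)
    then have "card {x \<in> A. (c, x) \<in> parcs G} \<le> out_degree (with_proj G) c"
      unfolding out_degree_with_proj by (rule card_mono) auto
    moreover have "2 \<le> card {x \<in> A. (c, x) \<in> parcs G}"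
      using assms c by (simp add: star_assembly_def)
    ultimately show ?thesis by linarith
  qed
  moreover have "out_degree (with_proj G) x = 1" if "x \<in> A" for x
    using assms that by (auto simp: star_assembly_def out_degree_with_proj)
  ultimately show ?thesis
    using assms by (auto simp: pendant_vertices_def star_assembly_def)
qed

lemma star_assembly_support:
  assumes "star_assembly G C A"
  shows "support_vertices G = {v \<in> pverts G. {x \<in> A. (v, x) \<in> parcs G} \<noteq> {}}"
  using star_assembly_pendant[OF assms] by (auto simp: support_vertices_def)

lemma star_assembly_star:
  assumes "is_star c p G" "3 \<le> p"
  obtains A where "star_assembly G {c} A" "G = star_graph c A" "c \<notin> A"
proof -
  obtain A where A: "finite A" "c \<notin> A" "G = star_graph c A"
    using assms(1) by (auto simp: is_star_def)
  have "p = Suc (card A)" using assms(1) A by (simp add: is_star_def star_graph_def)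
  then have "2 \<le> card A" using assms(2) by simp
  moreover have "{x \<in> A. (c, x) \<in> parcs G} = A" using A by (auto simp: star_graph_def)
  moreover have "{u. (x, u) \<in> parcs G} = {c}" if "x \<in> A" for x
    using A that by (auto simp: star_graph_def)
  ultimately have "star_assembly G {c} A"
    using A unfolding star_assembly_def by (auto simp: star_graph_def)
  then show thesis using that A by blast
qed

text \<open>The new edge joins two centres, so it changes neither the neighbourhood of a leaf nor
  the leaves at a centre.\<close>

lemma MR_family_assembly:
  assumes "G \<in> MR_family"
  shows "\<exists>C A. star_assembly G C A"
  using assms
proof induction
  case (star c p G)
  then show ?case using star_assembly_star by metis
next
  case (attach H w c q G)
  obtain C A where H: "star_assembly H C A" using attach.IH by auto
  obtain B where B: "star_assembly G {c} B" "G = star_graph c B" "c \<notin> B"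
    using star_assembly_star attach by metis
  have w: "w \<in> pverts H" "w \<notin> A"
  proof -
    show "w \<in> pverts H" using attach by (simp add: support_vertices_def)
    \<comment> \<open>A support vertex has a neighbour in \<open>A\<close>, whereas the only
      neighbour of a leaf is a centre.\<close>
    show "w \<notin> A"
    proof
      assume "w \<in> A"
      then obtain d where "d \<in> C" "{u. (w, u) \<in> parcs H} = {d}"
        using H by (auto simp: star_assembly_def)
      moreover obtain x where "x \<in> A" "(w, x) \<in> parcs H"
        using attach star_assembly_support[OF H] by auto
      ultimately show False using H by (auto simp: star_assembly_def)
    qed
  qed
  have disj: "pverts H \<inter> pverts G = {}" by fact
  have vH: "pverts H = C \<union> A" "parcs H \<subseteq> pverts H \<times> pverts H" using H by (auto simp: star_assembly_def)
  have vG: "pverts G = insert c B" "parcs G \<subseteq> pverts G \<times> pverts G"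
    using B(1) by (auto simp: star_assembly_def)
  let ?G = "\<lparr>pverts = pverts H \<union> pverts G, parcs = parcs H \<union> parcs G \<union> {(w, c), (c, w)}\<rparr>"
  have "star_assembly ?G (insert c C) (A \<union> B)"
    unfolding star_assembly_def
  proof (intro conjI ballI)
    fix x assume "x \<in> A \<union> B"
    then consider "x \<in> A" | "x \<in> B" by auto
    then show "\<exists>d\<in>insert c C. {u. (x, u) \<in> parcs ?G} = {d}"
    proof cases
      case 1
      then obtain d where d: "d \<in> C" "{u. (x, u) \<in> parcs H} = {d}"
        using H by (auto simp: star_assembly_def)
      have "{u. (x, u) \<in> parcs ?G} = {u. (x, u) \<in> parcs H}"
        using 1 disj vH vG w by auto
      then show ?thesis using d by auto
    next
      case 2
      then have "{u. (x, u) \<in> parcs G} = {c}"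
        using B(1) by (auto simp: star_assembly_def)
      moreover have "{u. (x, u) \<in> parcs ?G} = {u. (x, u) \<in> parcs G}"
        using 2 B(3) disj vH vG w by auto
      ultimately show ?thesis by auto
    qed
  next
    fix d assume "d \<in> insert c C"
    then consider "d = c" | "d \<in> C" by auto
    then show "2 \<le> card {x \<in> A \<union> B. (d, x) \<in> parcs ?G}"
    proof cases
      case 1
      have "{x \<in> A \<union> B. (d, x) \<in> parcs ?G} = {x \<in> B. (c, x) \<in> parcs G}"
        using 1 disj vH vG w by auto
      then show ?thesis using B(1) by (simp add: star_assembly_def)
    next
      case 2
      have "{x \<in> A \<union> B. (d, x) \<in> parcs ?G} = {x \<in> A. (d, x) \<in> parcs H}"
        using 2 disj vH vG B(3) by auto
      then show ?thesis using 2 H by (simp add: star_assembly_def)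
    qed
  qed (use H B w disj vH vG in \<open>auto simp: star_assembly_def\<close>)
  then show ?case by blast
qed

section \<open>Characterization of the family by \<open>R\<close> and the pendant neighbours\<close>

context large_tree
begin

text \<open>In an assembly of \<open>T\<close> the leaves are \<open>L\<close>. The centres have
  leaves as neighbours, so they lie in \<open>S\<close>; conversely \<open>S\<close> avoids
  \<open>L\<close>. Hence the centres are exactly \<open>S\<close>.\<close>

lemma MR_family_imp:
  assumes "T \<in> MR_family"
  shows "R = {}" and "c \<in> S \<Longrightarrow> 2 \<le> card (N c \<inter> L)"
proof -
  obtain C A where G: "star_assembly T C A" using MR_family_assembly[OF assms] by auto
  have L: "L = A" using star_assembly_pendant[OF G] .
  have NL: "N c \<inter> L = {x \<in> A. (c, x) \<in> parcs T}" for c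
    using N_sym by (auto simp: L parcs_iff_N)
  have C: "2 \<le> card (N c \<inter> L)" if "c \<in> C" for c
    using G that by (simp add: star_assembly_def NL)
  have "N c \<inter> L \<noteq> {}" if "c \<in> C" for c using C[OF that] by auto
  then have "C \<subseteq> S" using mem_S by auto
  then show "R = {}" using G L by (auto simp: R_def star_assembly_def)
  show "2 \<le> card (N c \<inter> L)" if "c \<in> S" 
  proof -
    have "c \<in> C" using that S_L_disjoint S_verts G L by (auto simp: star_assembly_def)
    then show ?thesis by (rule C)
  qed
qed

text \<open>For \<open>B\<close> containing the root and closed under parents, these induced
  subgraphs are the intermediate trees of the construction.\<close>

definition star_part :: "'a set \<Rightarrow> 'a pair_pre_digraph" where
  "star_part B = (let V = B \<union> (\<Union>c\<in>B. N c \<inter> L) in \<lparr>pverts = V, parcs = parcs T \<inter> V \<times> V\<rparr>)"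

lemma pverts_star_part: "pverts (star_part B) = B \<union> (\<Union>c\<in>B. N c \<inter> L)"
  by (simp add: star_part_def Let_def)

lemma parcs_star_part: "(a, b) \<in> parcs (star_part B) \<longleftrightarrow>
    a \<in> N b \<and> a \<in> pverts (star_part B) \<and> b \<in> pverts (star_part B)"
  by (simp add: star_part_def Let_def parcs_iff_N)

lemma star_is_star:
  assumes "c \<in> S" "2 \<le> card (N c \<inter> L)"
  shows "is_star c (Suc (card (N c \<inter> L))) (star_graph c (N c \<inter> L))"
proof -
  have "c \<notin> L" using assms(1) S_L_disjoint by auto
  then show ?thesis by (auto simp: is_star_def star_graph_def intro!: exI[of _ "N c \<inter> L"])
qed

text \<open>Root the tree at a support vertex and detach the star at a deepest support vertex, which
  hangs on the star of its parent. The induction runs over all parent-closed \<open>B\<close>, and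
  \<open>B = S\<close> gives \<open>T\<close>.\<close>

lemma MR_family_of_pendants:
  assumes R: "R = {}" and two: "\<And>c. c \<in> S \<Longrightarrow> 2 \<le> card (N c \<inter> L)"
  shows "T \<in> MR_family"
proof -
  have V: "pverts T = S \<union> L" using R S_verts L_verts by (auto simp: R_def)
  have "S \<noteq> {}"
    using V order_ge_3 L_eq_UN by auto
  then obtain \<rho> where \<rho>: "\<rho> \<in> S" by auto
  obtain par dep where par: "\<And>v. v \<in> pverts T \<Longrightarrow> v \<noteq> \<rho> \<Longrightarrow> par v \<in> N v \<and> dep v = Suc (dep (par v) :: nat)"
    and edge: "\<And>u v. u \<in> N v \<Longrightarrow> (u \<noteq> \<rho> \<and> v = par u) \<or> (v \<noteq> \<rho> \<and> u = par v)"
    using rooted[of \<rho>] \<rho> S_verts by blast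
  \<comment> \<open>A pendant parent has \<open>c\<close> as its only neighbour, so \<open>c\<close>
    would be its parent in turn and each would be deeper than the other.\<close>
  have par_S: "par c \<in> S" if c: "c \<in> S" "c \<noteq> \<rho>" for c
  proof (rule ccontr)
    have pc: "par c \<in> N c" "dep c = Suc (dep (par c))" using par[of c] c S_verts by auto
    assume "par c \<notin> S"
    then have "par c \<in> L" using pc(1) N_verts V by auto
    then obtain d where d: "N (par c) = {d}" using pendant_nbr by blast
    have "par c \<noteq> \<rho>" using \<open>par c \<notin> S\<close> \<rho> by auto
    then have "par (par c) = c" "dep (par c) = Suc (dep (par (par c)))"
      using par[of "par c"] d pc(1) N_verts N_sym by (metis singletonD)+
    then show False using pc(2) by simp
  qed
  have pendant_edge: "d = c" if "x \<in> N c" "x \<in> L" "x \<in> N d" for x c d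
    using that N_sym by (metis pendant_nbr singletonD)
  have star_part_singleton: "star_part {c} = star_graph c (N c \<inter> L)" if "c \<in> S" for c
  proof -
    have "c \<notin> L" using that S_L_disjoint by auto
    then have "(a, b) \<in> parcs (star_part {c}) \<longleftrightarrow> (a, b) \<in> parcs (star_graph c (N c \<inter> L))" for a b
      using pendant_edge[of a c b] pendant_edge[of b c a] not_in_N N_sym
      by (auto simp: parcs_star_part pverts_star_part star_graph_def)
    then show ?thesis
      by (intro pair_pre_digraph.equality) (auto simp: pverts_star_part star_graph_def)
  qed
  have family: "star_part B \<in> MR_family"
    if "B \<subseteq> S" "\<rho> \<in> B" "\<And>c. c \<in> B \<Longrightarrow> c \<noteq> \<rho> \<Longrightarrow> par c \<in> B" for B
    using that
  proof (induction "card B" arbitrary: B rule: less_induct)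
    case less
    have finB: "finite B" using less.prems(1) finite_S by (rule finite_subset)
    have BL: "B \<inter> L = {}" using less.prems(1) S_L_disjoint by auto
    show ?case
    proof (cases "B = {\<rho>}")
      case True
      then have "star_part B = star_graph \<rho> (N \<rho> \<inter> L)" using star_part_singleton \<rho> by simp
      then show ?thesis using MR_family.star[OF star_is_star[OF \<rho> two[OF \<rho>]]] two[OF \<rho>] by simp
    next
      case False
      \<comment> \<open>A deepest \<open>c\<close> is the parent of no vertex of \<open>B\<close>,
        so \<open>B - {c}\<close> stays closed under parents.\<close>
      obtain c where c: "c \<in> B" "c \<noteq> \<rho>" "\<And>d. d \<in> B \<Longrightarrow> d \<noteq> \<rho> \<Longrightarrow> dep d \<le> dep c"
        using Max_in[of "dep ` (B - {\<rho>})"] Max_ge[of "dep ` (B - {\<rho>})"] False less.prems(2) finB by fastforce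
      let ?B = "B - {c}"
      have cS: "c \<in> S" using c(1) less.prems(1) by auto
      have no_child: "par d \<noteq> c" if "d \<in> B" "d \<noteq> \<rho>" for d
        using c(3)[OF that] par[of d] that less.prems(1) S_verts by auto
      have H: "star_part ?B \<in> MR_family"
        by (rule less.hyps[OF card_Diff1_less[OF finB c(1)]]) (use less.prems c(2) no_child in auto)
      have pc: "par c \<in> ?B" "par c \<in> N c"
        using less.prems(3)[OF c(1,2)] par[of c] c cS S_verts not_in_N by auto
      have pcS: "par c \<in> S" using pc(1) less.prems(1) by auto
      \<comment> \<open>Support has to be checked in the smaller graph: \<open>x\<close> and its
        only neighbour \<open>par c\<close> both survive there, so \<open>x\<close> is still
        pendant.\<close>
      obtain x where x: "x \<in> N (par c)" "x \<in> L" using pcS mem_S by auto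
      have "{u. (x, u) \<in> parcs (star_part ?B)} = {par c}"
      proof -
        have "N x = {par c}" using x N_sym by (metis pendant_nbr singletonD)
        moreover have "x \<in> pverts (star_part ?B)" "par c \<in> pverts (star_part ?B)"
          using x pc(1) by (auto simp: pverts_star_part)
        ultimately show ?thesis using N_sym by (auto simp: parcs_star_part)
      qed
      then have "x \<in> pendant_vertices (star_part ?B)"
        using x pc(1) by (auto simp: pendant_vertices_def out_degree_with_proj pverts_star_part)
      then have sup: "par c \<in> support_vertices (star_part ?B)"
        using x pc(1) N_sym by (auto simp: support_vertices_def pverts_star_part parcs_star_part)
      have disj: "pverts (star_part ?B) \<inter> pverts (star_graph c (N c \<inter> L)) = {}"
        using pendant_edge BL cS S_L_disjoint by (auto simp: pverts_star_part star_graph_def)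
      \<comment> \<open>Pendant vertices have no edges leaving their star, so a connecting edge
        joins \<open>c\<close> to another centre; it is a parent edge, and \<open>c\<close> has no
        child in \<open>B\<close>.\<close>
      have cross: "a = c \<and> b = par c"
        if a: "a \<in> pverts (star_part {c})" and b: "b \<in> pverts (star_part ?B)" and ab: "a \<in> N b" for a b
      proof -
        have "b \<noteq> c"
          using b cS S_L_disjoint by (auto simp: pverts_star_part)
        then have "a = c"
          using a ab pendant_edge[of a c b] by (auto simp: pverts_star_part)
        moreover have "b \<in> ?B"
          using b ab pendant_edge[of b _ c] \<open>a = c\<close> N_sym by (auto simp: pverts_star_part)
        ultimately show ?thesis
          using edge[OF ab] no_child[of b] by auto
      qed
      have verts: "pverts (star_part B) = pverts (star_part ?B) \<union> pverts (star_part {c})"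
        using c(1) by (auto simp: pverts_star_part)
      have "(a, b) \<in> parcs (star_part B) \<longleftrightarrow>
          (a, b) \<in> parcs (star_part ?B) \<union> parcs (star_part {c}) \<union> {(par c, c), (c, par c)}" for a b
      proof -
        have "c \<in> pverts (star_part {c})" "par c \<in> pverts (star_part ?B)"
          using pc(1) by (auto simp: pverts_star_part)
        then show ?thesis
          unfolding parcs_star_part verts Un_iff
          using cross[of a b] cross[of b a] pc(2) N_sym[of a b] N_sym[of c "par c"] by auto
      qed
      then have "star_part B = \<lparr>pverts = pverts (star_part ?B) \<union> pverts (star_graph c (N c \<inter> L)),
          parcs = parcs (star_part ?B) \<union> parcs (star_graph c (N c \<inter> L)) \<union> {(par c, c), (c, par c)}\<rparr>"
        using verts star_part_singleton[OF cS] by (intro pair_pre_digraph.equality) auto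
      then show ?thesis
        using MR_family.attach[OF H sup star_is_star[OF cS two[OF cS]] _ disj] two[OF cS] by simp
    qed
  qed
  have "star_part S \<in> MR_family"
    by (rule family) (use \<rho> par_S in auto)
  moreover have "star_part S = T"
  proof (intro pair_pre_digraph.equality)
    show v: "pverts (star_part S) = pverts T" using V L_eq_UN by (simp add: pverts_star_part)
    show "parcs (star_part S) = parcs T"
      using N_verts v by (force simp: parcs_star_part parcs_iff_N)
  qed simp
  ultimately show ?thesis by simp
qed

end

theorem theorem15:
  fixes T :: "'a pair_pre_digraph" and n s l :: nat
  assumes "undirected_tree T"
    and "n = card (pverts T)" and "n \<ge> 3"
    and "s = card (support_vertices T)"
    and "l = card (pendant_vertices T)"
  shows "MR_domination_number T \<le> \<lceil>(real n + 7 * real s - 5 * real l) / 4\<rceil> \<and>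
         (MR_domination_number T = \<lceil>(real n + 7 * real s - 5 * real l) / 4\<rceil> \<longleftrightarrow> T \<in> MR_family)"
proof -
  interpret pair_graph T using assms(1) by (simp add: undirected_tree_def)
  interpret large_tree T
    using assms(1-3) by unfold_locales (auto simp: undirected_tree_def not_le[symmetric])
  define bound where "bound = (real n + 7 * real s - 5 * real l) / 4"
  \<comment> \<open>Thus \<open>bound\<close> is \<open>2 s - l\<close> plus a quarter of
    \<open>card R\<close>, an integer when \<open>R\<close> is empty.\<close>
  have bound: "4 * bound = 8 * real (card S) - 4 * real (card L) + real (card R)"
    using card_verts assms(2,4,5) by (simp add: bound_def)
  show ?thesis
  proof (cases "R = {} \<and> (\<forall>c\<in>S. 2 \<le> card (N c \<inter> L))")
    case True
    then have "MR_domination_number T = 2 * int (card S) - int (card L)"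
      using gamma_le_of_no_R gamma_ge_of_pendants by (intro antisym) auto
    moreover have "bound = of_int (2 * int (card S) - int (card L))"
      using bound True by simp
    then have "\<lceil>bound\<rceil> = 2 * int (card S) - int (card L)"
      by (simp only: ceiling_of_int)
    ultimately show ?thesis
      using MR_family_of_pendants True by (simp add: bound_def)
  next
    case False
    have "4 * MR_domination_number T < 8 * int (card S) - 4 * int (card L) + int (card R)"
    proof (cases "R = {}")
      case True
      then obtain c where c: "c \<in> S" "card (N c \<inter> L) < 2" using False by auto
      then have "card (N c \<inter> L) = 1"
        using mem_S[of c] card_gt_0_iff[of "N c \<inter> L"] by auto
      then show ?thesis using gamma_lt_of_single_pendant[OF True c(1)] by simp
    qed (rule gamma_lt_of_R)
    then have "real_of_int (4 * MR_domination_number T)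
      < real_of_int (8 * int (card S) - 4 * int (card L) + int (card R))"
      by (simp only: of_int_less_iff)
    then have "real_of_int (MR_domination_number T) < bound"
      using bound by simp
    \<comment> \<open>An integer strictly below \<open>bound\<close> is strictly below its ceiling,
      so rounding up cannot restore equality.\<close>
    then have "MR_domination_number T < \<lceil>bound\<rceil>"
      by (simp add: less_ceiling_iff)
    moreover have "T \<notin> MR_family" using False MR_family_imp by auto
    ultimately show ?thesis by (simp add: bound_def)
  qed
qed

end
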